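(* Let $T$ be an ergodic measure-preserving map on the probability space $(X,\mathcal{A},\mu)$, and $(A_l)_{l\ge 1}$ a sequence in $\mathcal{A}$ such that $0<\mu(A_l)\to 0$ as $l\to\infty$. (a) Suppose that the normalized hitting times converge to some sub-probability distribution function $F$ on $[0,\infty)$, $$\mu\big(\mu(A_l)\,\varphi_{A_l}\le t\big)\Longrightarrow F(t)\qquad\text{as } l\to\infty. \qquad ( * )$$ Then, for sequences $(k_l)_{l\ge 1}$ of positive integers, $$\mu(\varphi_{A_l}=k_l)\sim F'(t)\cdot\mu(A_l)\qquad\text{as } l\to\infty$$ whenever $\mu(A_l)k_l\to t>0$ and $F'$ is continuous at $t$. (b) Conversely, assume that $D$ is a Borel subset of $(0,\infty)$ whose complement $(0,\infty)\setminus D$ has Lebesgue measure $0$, and that $G:D\to[0,\infty)$ is such that, for sequences $(k_l)_{l\ge 1}$ of positive integers, $$\mu(\varphi_{A_l}=k_l)\sim G(t)\cdot\mu(A_l)\quad\text{as } l\to\infty\qquad\text{whenever } \mu(A_l)k_l\to t\in D.$$ Then $( * )$ holds with $F(t):=\int_0^t G(s)\,ds$, $t>0$. (c) Under $( * )$, if $F'$ is continuous and strictly positive on an open interval $I\subseteq(0,\infty)$, then, for every compact subset $J$ of $I$, $$\mu(\varphi_{A_l}=k_l)\sim F'(\mu(A_l)k_l)\cdot\mu(A_l)\qquad\text{as } l\to\infty,\ \text{uniformly in } (k_l)\in\mathcal{K}_J(A_l),$$ where $\mathcal{K}_J(A_l):=\{(k_l)_{l\ge 1}: k_l\in\mathbb{N},\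 \mu(A_l)k_l\in J\text{ for } l\ge 1\}$.
   Context: For $A\in\mathcal{A}$ the hitting time function is $\varphi_A(x):=\inf\{n\ge 1: T^n x\in A\}\in\{1,2,\ldots,\infty\}$, $x\in X$; it is finite a.e. if $\mu(A)>0$. For sub-probability distribution functions on $[0,\infty)$, $F_l(t)\Rightarrow F(t)$ means $F_l(t)\to F(t)$ at every continuity point $t$ of $F$. It is known that any limit $F$ as in $( * )$ is continuous and concave with $F(t)\le t$, hence absolutely continuous; $F'$ denotes the unique right-continuous version of its derivative on $[0,\infty)$ having left-hand limits everywhere (a non-increasing function). Notation: $a_n\sim c\cdot b_n$ with $c\in[0,\infty)$ means that $b_n>0$ for large $n$ and $a_n/b_n\to c$; for $c=0$ this says $a_n=o(b_n)$. In (c), uniformity of $a_l\sim b_l$ in $(k_l)\in\mathcal{K}_J(A_l)$ means: for every $\varepsilon>0$ there is $l_0$ such that $|a_l/b_l-1|<\varepsilon$ for all $l\ge l_0$ and all $(k_l)\in\mathcal{K}_J(A_l)$. *)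

theory Defs
  imports "HOL-Probability.Probability"
begin

locale ergodic_system = prob_space M for M :: "'a measure" +
  fixes T :: "'a \<Rightarrow> 'a"
  assumes measurable_T: "T \<in> measurable M M"
    and measure_preserving: "distr M M T = M"
    and ergodic: "\<And>B. B \<in> sets M \<Longrightarrow> T -` B \<inter> space M = B \<Longrightarrow>
      measure M B = 0 \<or> measure M B = 1"

(* The infimum of the empty set in enat is \<infinity>. *)
definition hit_time :: "('a \<Rightarrow> 'a) \<Rightarrow> 'a set \<Rightarrow> 'a \<Rightarrow> enat" where
  "hit_time T A x = (INF n \<in> {n. 1 \<le> n \<and> (T ^^ n) x \<in> A}. enat n)"

(* Functions on [0,\<infinity>) are represented by total functions on the reals
   whose values at negative arguments are irrelevant. *)
definition subprob_dist_fun :: "(real \<Rightarrow> real) \<Rightarrow> bool" where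
  "subprob_dist_fun F \<longleftrightarrow>
     mono_on {0..} F \<and>
     (\<forall>t\<ge>0. continuous (at_right t) F) \<and>
     (\<forall>t\<ge>0. 0 \<le> F t \<and> F t \<le> 1)"

definition weak_conv_nonneg :: "(nat \<Rightarrow> real \<Rightarrow> real) \<Rightarrow> (real \<Rightarrow> real) \<Rightarrow> bool" where
  "weak_conv_nonneg Fs F \<longleftrightarrow>
     (\<forall>t\<ge>0. continuous (at t within {0..}) F \<longrightarrow> (\<lambda>l. Fs l t) \<longlonglongrightarrow> F t)"

(* The product is taken in ereal, so that it is \<infinity> where the hitting time is
   infinite and A has positive measure. *)
definition hit_dist_fun :: "'a measure \<Rightarrow> ('a \<Rightarrow> 'a) \<Rightarrow> 'a set \<Rightarrow> real \<Rightarrow> real" where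
  "hit_dist_fun M T A t =
     measure M {x \<in> space M. ereal (measure M A) * ereal_of_enat (hit_time T A x) \<le> ereal t}"

definition hit_times_converge ::
  "'a measure \<Rightarrow> ('a \<Rightarrow> 'a) \<Rightarrow> (nat \<Rightarrow> 'a set) \<Rightarrow> (real \<Rightarrow> real) \<Rightarrow> bool" where
  "hit_times_converge M T A F \<longleftrightarrow>
     subprob_dist_fun F \<and> weak_conv_nonneg (\<lambda>l. hit_dist_fun M T (A l)) F"

definition hit_prob :: "'a measure \<Rightarrow> ('a \<Rightarrow> 'a) \<Rightarrow> 'a set \<Rightarrow> nat \<Rightarrow> real" where
  "hit_prob M T A k = measure M {x \<in> space M. hit_time T A x = enat k}"

(* The right-continuous version, with left-hand limits, of the derivative of F on [0,\<infinity>).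
   It is unique on [0,\<infinity>), as right-continuous functions that agree almost everywhere are equal;
   the value 0 at negative arguments makes it unique as a total function.
   It exists for every continuous concave F with 0 \<le> F t \<le> t. *)
definition rc_deriv :: "(real \<Rightarrow> real) \<Rightarrow> real \<Rightarrow> real" where
  "rc_deriv F = (THE f.
     (AE t in lborel. 0 < t \<longrightarrow> (F has_real_derivative f t) (at t)) \<and>
     (\<forall>t\<ge>0. continuous (at_right t) f) \<and>
     (\<forall>t>0. \<exists>L. (f \<longlongrightarrow> L) (at_left t)) \<and>
     (\<forall>t<0. f t = 0))"

(* a_n \<sim> c * b_n, where c = 0 is allowed and then says a_n = o(b_n). *)
definition sim_const :: "(nat \<Rightarrow> real) \<Rightarrow> real \<Rightarrow> (nat \<Rightarrow> real) \<Rightarrow> bool" where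
  "sim_const a c b \<longleftrightarrow>
     (\<forall>\<^sub>F n in sequentially. 0 < b n) \<and> (\<lambda>n. a n / b n) \<longlonglongrightarrow> c"

(* Sequences are indexed by l \<ge> 1; the entry at 0 is irrelevant. *)
definition pos_seqs :: "(nat \<Rightarrow> nat) set" where
  "pos_seqs = {k. \<forall>l\<ge>1. 1 \<le> k l}"

definition K_seqs :: "'a measure \<Rightarrow> (nat \<Rightarrow> 'a set) \<Rightarrow> real set \<Rightarrow> (nat \<Rightarrow> nat) set" where
  "K_seqs M A J = {k \<in> pos_seqs. \<forall>l\<ge>1. measure M (A l) * real (k l) \<in> J}"

definition sim_uniformly ::
  "('k \<Rightarrow> nat \<Rightarrow> real) \<Rightarrow> ('k \<Rightarrow> nat \<Rightarrow> real) \<Rightarrow> 'k set \<Rightarrow> bool" where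
  "sim_uniformly a b K \<longleftrightarrow>
     (\<forall>\<epsilon>>0. \<exists>l0\<ge>1. \<forall>l\<ge>l0. \<forall>k\<in>K. \<bar>a k l / b k l - 1\<bar> < \<epsilon>)"

end

theory Submission
  imports Defs
begin

text \<open>
  The point is that the sequence of hitting probabilities is non-increasing from index 1 on, because
  a point hits A first at time k + 1 only if its image hits A first at time k. Hence the normalized
  hitting time distribution functions are, up to an error of the order of the measure of A, concave
  and 1-Lipschitz, and a single hitting probability is trapped between difference quotients of the
  distribution function to its left and to its right. In the limit these are difference quotients
  of F, which in turn lie between values of its derivative; this gives (a), and (c) by compactness.
  For (b), the distribution function is the integral of the step function whose values are the
  normalized hitting probabilities, which are bounded by 1, and dominated convergence applies.
\<close>

section \<open>Concave Lipschitz functions on the half-line\<close>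

text \<open>Right continuity would extend a difference at \<open>t\<close> to an interval to the
  right of \<open>t\<close>, which is not a null set. This is the uniqueness half of the description
  of \<open>rc_deriv\<close>.\<close>

lemma AE_eq_right_continuous_imp_eq:
  fixes f g :: "real \<Rightarrow> real"
  assumes "AE s in lborel. a < s \<longrightarrow> f s = g s"
    and "a \<le> t" "continuous (at_right t) f" "continuous (at_right t) g"
  shows "f t = g t"
proof (rule ccontr)
  assume "f t \<noteq> g t"
  moreover have "((\<lambda>s. f s - g s) \<longlongrightarrow> f t - g t) (at_right t)"
    using assms(3,4) by (auto simp: continuous_within intro!: tendsto_diff)
  ultimately have "\<forall>\<^sub>F s in at_right t. f s - g s \<noteq> 0"
    by (intro tendsto_imp_eventually_ne) auto
  then obtain b where b: "b > t" "\<And>s. t < s \<Longrightarrow> s < b \<Longrightarrow> f s \<noteq> g s"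
    by (auto simp: eventually_at_right_field)
  have "AE s in lborel. s \<notin> {t<..<b}"
    using assms(1) by eventually_elim (use b assms(2) in auto)
  then have "{t<..<b} \<in> null_sets lborel"
    by (subst (asm) AE_iff_null_sets[symmetric]) auto
  then show False
    using b(1) by (auto simp: null_sets_def)
qed

text \<open>For concave \<open>F\<close> the slopes grow as \<open>u\<close> decreases to
  \<open>t\<close>, so this supremum is the right derivative. As a supremum it can be used before
  any limit is known to exist.\<close>

definition right_slope :: "(real \<Rightarrow> real) \<Rightarrow> real \<Rightarrow> real" where
  "right_slope F t = (SUP u\<in>{t<..}. (F u - F t) / (u - t))"

text \<open>The Lipschitz bound keeps the slopes bounded up to the endpoint 0, where concavity alone
  would allow an infinite right derivative. Limits of hitting time distribution functions satisfy it
  with \<open>L = 1\<close>.\<close>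

locale concave_lipschitz =
  fixes F :: "real \<Rightarrow> real" and L :: real
  assumes lip: "L-lipschitz_on {0..} F"
    and concave: "concave_on {0..} F"
begin

lemma continuous_on_nonneg: "continuous_on {0..} F"
  by (rule lipschitz_on_continuous_on[OF lip])

lemma slope_le_lipschitz: "(F u - F t) / (u - t) \<le> L" if "0 \<le> t" "t < u"
  using lipschitz_onD[OF lip, of u t] that
  by (simp add: dist_real_def divide_le_eq abs_le_iff)

lemma slope_le_slope: "(F u - F t) / (u - t) \<le> (F t - F s) / (t - s)" if "0 \<le> s" "s < t" "t < u"
proof -
  have "convex_on {0..} (\<lambda>x. - F x)"
    using concave by (simp add: concave_on_def)
  note c = convex_on_slope_le[OF this, of s u t]
  have "(- F s - - F t) / (s - t) \<le> (- F t - - F u) / (t - u)"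
    using c that by (meson atLeast_iff dual_order.strict_iff_order order_trans)
  then show ?thesis
    using that by (simp add: divide_simps mult.commute split: if_splits) (simp add: algebra_simps)
qed

lemma bdd_above_slopes: "bdd_above ((\<lambda>u. (F u - F t) / (u - t)) ` {t<..})" if "0 \<le> t"
  using slope_le_lipschitz[OF that] by (auto intro!: bdd_aboveI2)

lemma slope_le_right_slope: "(F b - F a) / (b - a) \<le> right_slope F a" if "0 \<le> a" "a < b"
  unfolding right_slope_def using that by (auto intro!: cSUP_upper2[OF bdd_above_slopes])

lemma right_slope_le_slope: "right_slope F b \<le> (F b - F a) / (b - a)" if "0 \<le> a" "a < b"
  unfolding right_slope_def using that by (auto intro!: cSUP_least slope_le_slope)

lemma right_slope_antimono: "right_slope F b \<le> right_slope F a" if "0 \<le> a" "a \<le> b"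
  using right_slope_le_slope[of a b] slope_le_right_slope[of a b] that by (cases "a = b") auto

text \<open>The lower estimate holds because the function is a supremum of slopes, each of which is
  continuous in its left endpoint; the upper estimate is monotonicity.\<close>

lemma right_slope_right_continuous:
  assumes "0 \<le> t"
  shows "continuous (at_right t) (right_slope F)"
  unfolding continuous_within
proof (rule order_tendstoI)
  fix y assume "y < right_slope F t"
  then obtain u where u: "t < u" "y < (F u - F t) / (u - t)"
    unfolding right_slope_def using less_cSUP_iff[OF _ bdd_above_slopes[OF assms]] by auto
  have "(F \<longlongrightarrow> F t) (at_right t)"
    using continuous_on_nonneg assms unfolding continuous_on_def
    by (metis atLeast_iff greaterThan_iff less_eq_real_def order_trans subsetI tendsto_within_subset)
  then have "((\<lambda>s. (F u - F s) / (u - s)) \<longlongrightarrow> (F u - F t) / (u - t)) (at_right t)"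
    using u by (auto intro!: tendsto_intros)
  then have "\<forall>\<^sub>F s in at_right t. y < (F u - F s) / (u - s)"
    using u(2) by (rule order_tendstoD)
  moreover have "\<forall>\<^sub>F s in at_right t. s \<in> {t<..<u}"
    using u(1) by (rule eventually_at_right_real)
  ultimately show "\<forall>\<^sub>F s in at_right t. y < right_slope F s"
  proof eventually_elim
    case (elim s)
    then show ?case
      using slope_le_right_slope[of s u] assms by force
  qed
next
  fix y assume y: "right_slope F t < y"
  have "\<forall>\<^sub>F s in at_right t. t < s"
    by (simp add: eventually_at_right_less)
  then show "\<forall>\<^sub>F s in at_right t. right_slope F s < y"
    by eventually_elim (use right_slope_antimono[OF assms] y in \<open>meson less_imp_le order_le_less_trans\<close>)
qed

lemma right_slope_left_limit: "\<exists>l. (right_slope F \<longlongrightarrow> l) (at_left t)" if "0 < t"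
proof -
  \<comment> \<open>The negated function is nondecreasing and bounded above on
    \<open>{0<..<t}\<close>, so its left limit is its supremum there. The restriction to positive
    arguments, where monotonicity is known, is removed afterwards.\<close>
  have "((\<lambda>s. - right_slope F s) \<longlongrightarrow> (SUP s\<in>{..<t} \<inter> {0<..}. - right_slope F s)) (at t within ({..<t} \<inter> {0<..}))"
    by (rule Lim_left_bound[where K = "- right_slope F t"]) (auto intro!: right_slope_antimono)
  then have "(right_slope F \<longlongrightarrow> - (SUP s\<in>{..<t} \<inter> {0<..}. - right_slope F s)) (at t within ({..<t} \<inter> {0<..}))"
    using tendsto_minus by force
  moreover have "at t within ({..<t} \<inter> {0<..}) = at_left t"
    by (rule at_within_nhd[of _ "{0<..}"]) (use that in auto)
  ultimately show ?thesis
    by auto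
qed

text \<open>On either side of \<open>t\<close> the slope between \<open>s\<close> and
  \<open>t\<close> lies between the right slopes at \<open>s\<close> and at \<open>t\<close>. Its
  distance from \<open>right_slope F s\<close> is at most the difference of these two, which
  vanishes by continuity at \<open>t\<close>.\<close>

lemma has_derivative_right_slope:
  "(F has_real_derivative right_slope F t) (at t)" if "0 < t" "isCont (right_slope F) t"
  unfolding has_field_derivative_iff
proof (rule Lim_transform[OF _ Lim_null_comparison])
  show "(right_slope F \<longlongrightarrow> right_slope F t) (at t)"
    using that(2) by (simp add: isCont_def)
  show "((\<lambda>s. \<bar>right_slope F s - right_slope F t\<bar>) \<longlongrightarrow> 0) (at t)"
    using that(2) by (simp add: isCont_def LIM_zero tendsto_rabs_zero)
  have "\<forall>\<^sub>F s in at t. s \<in> {0<..} - {t}"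
    using that(1) by (intro eventually_at_in_open) auto
  then show "\<forall>\<^sub>F s in at t. norm ((F s - F t) / (s - t) - right_slope F s) \<le> \<bar>right_slope F s - right_slope F t\<bar>"
  proof eventually_elim
    case (elim s)
    show ?case
    proof (cases "s < t")
      case True
      have "(F t - F s) / (t - s) = (F s - F t) / (s - t)"
        by (metis minus_diff_eq minus_divide_divide)
      then show ?thesis
        using slope_le_right_slope[of s t] right_slope_le_slope[of s t] elim True by auto
    next
      case False
      then show ?thesis
        using slope_le_right_slope[of t s] right_slope_le_slope[of t s] elim that(1) by auto
    qed
  qed
qed

text \<open>A monotone function has only countably many discontinuities, and at every other positive
  point the preceding lemma applies.\<close>

lemma AE_has_derivative_right_slope:
  "AE t in lborel. 0 < t \<longrightarrow> (F has_real_derivative right_slope F t) (at t)"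
proof (rule AE_I')
  have "mono_on {0<..} (\<lambda>t. - right_slope F t)"
    by (auto intro!: mono_onI right_slope_antimono)
  then have "countable {t\<in>{0<..}. \<not> isCont (\<lambda>t. - right_slope F t) t}"
    by (intro mono_on_ctble_discont_open) auto
  then show "{t\<in>{0<..}. \<not> isCont (\<lambda>t. - right_slope F t) t} \<in> null_sets lborel"
    by (rule countable_imp_null_set_lborel)
  have "isCont (right_slope F) t" if "isCont (\<lambda>t. - right_slope F t) t" for t
    using continuous_minus[OF that] by simp
  then show "{t\<in>space lborel. \<not> (0 < t \<longrightarrow> (F has_real_derivative right_slope F t) (at t))}
      \<subseteq> {t\<in>{0<..}. \<not> isCont (\<lambda>t. - right_slope F t) t}"
    using has_derivative_right_slope by auto
qed

text \<open>Two candidates agree almost everywhere because derivatives are unique, and then on the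
  whole half-line by right continuity. Setting the values at negative arguments to 0 affects none of
  the one-sided limits involved.\<close>

lemma rc_deriv_eq: "rc_deriv F = (\<lambda>t. if t < 0 then 0 else right_slope F t)" (is "_ = ?g")
  unfolding rc_deriv_def
proof (rule the_equality)
  have right: "continuous (at_right t) ?g" if "0 \<le> t" for t
  proof -
    have "\<forall>\<^sub>F s in at_right t. right_slope F s = ?g s"
      using eventually_at_right_less[of t] by eventually_elim (use that in auto)
    then show ?thesis
      using right_slope_right_continuous[OF that] that tendsto_cong
      by (fastforce simp: continuous_within)
  qed
  have left: "\<exists>l. (?g \<longlongrightarrow> l) (at_left t)" if "0 < t" for t
  proof -
    have "\<forall>\<^sub>F s in at_left t. right_slope F s = ?g s"
      using eventually_at_left_real[OF that] by eventually_elim auto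
    then show ?thesis
      using right_slope_left_limit[OF that] tendsto_cong by fast
  qed
  have AE: "AE t in lborel. 0 < t \<longrightarrow> (F has_real_derivative ?g t) (at t)"
    using AE_has_derivative_right_slope by eventually_elim auto
  show "(AE t in lborel. 0 < t \<longrightarrow> (F has_real_derivative ?g t) (at t)) \<and>
      (\<forall>t\<ge>0. continuous (at_right t) ?g) \<and> (\<forall>t>0. \<exists>l. (?g \<longlongrightarrow> l) (at_left t)) \<and> (\<forall>t<0. ?g t = 0)"
    using right left AE by simp
  fix f
  assume f: "(AE t in lborel. 0 < t \<longrightarrow> (F has_real_derivative f t) (at t)) \<and>
      (\<forall>t\<ge>0. continuous (at_right t) f) \<and> (\<forall>t>0. \<exists>l. (f \<longlongrightarrow> l) (at_left t)) \<and> (\<forall>t<0. f t = 0)"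
  have "AE t in lborel. 0 < t \<longrightarrow> f t = ?g t"
    using conjunct1[OF f] AE by eventually_elim (blast dest: DERIV_unique)
  then have "f t = ?g t" if "0 \<le> t" for t
    using AE_eq_right_continuous_imp_eq[of 0 f ?g t] f right that by blast
  then show "f = ?g"
    using f by (intro ext) (metis linorder_not_less)
qed

text \<open>Concavity puts the slope over an interval between the derivatives at its endpoints. This
  bound and the next one are how values of \<open>rc_deriv\<close> enter the limit argument.\<close>

lemma rc_deriv_le_slope: "rc_deriv F b \<le> (F b - F a) / (b - a)" if "0 \<le> a" "a < b"
  using right_slope_le_slope[OF that] that by (simp add: rc_deriv_eq)

lemma slope_le_rc_deriv: "(F b - F a) / (b - a) \<le> rc_deriv F a" if "0 \<le> a" "a < b"
  using slope_le_right_slope[OF that] that by (simp add: rc_deriv_eq)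

end

section \<open>Hitting probabilities of a single set\<close>

text \<open>The difference of the floors counts the integers in \<open>{x<..y}\<close>. After
  scaling by the measure of the target, the error 1 becomes an error of that measure.\<close>

lemma nat_floor_diff_le:
  fixes x y :: real
  assumes "0 \<le> x" "x \<le> y"
  shows "real (nat \<lfloor>y\<rfloor> - nat \<lfloor>x\<rfloor>) \<le> y - x + 1"
    and "y - x - 1 \<le> real (nat \<lfloor>y\<rfloor> - nat \<lfloor>x\<rfloor>)"
  using assms floor_mono[OF assms(2)] by (simp_all add: of_nat_diff nat_mono; linarith)+

text \<open>A condition on finitely many iterates, in place of an infimum, makes the level sets
  visibly measurable and shows how they behave under \<open>T\<close>.\<close>

lemma hit_time_eq_enat_iff:
  "hit_time T A x = enat k \<longleftrightarrow>
     1 \<le> k \<and> (T ^^ k) x \<in> A \<and> (\<forall>j\<in>{1..<k}. (T ^^ j) x \<notin> A)"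
proof (cases "\<exists>n\<ge>1. (T ^^ n) x \<in> A")
  case True
  define N where "N = (LEAST n. 1 \<le> n \<and> (T ^^ n) x \<in> A)"
  have N: "1 \<le> N" "(T ^^ N) x \<in> A"
    using LeastI_ex[of "\<lambda>n. 1 \<le> n \<and> (T ^^ n) x \<in> A"] True by (auto simp: N_def)
  have N_le: "N \<le> n" if "1 \<le> n" "(T ^^ n) x \<in> A" for n
    unfolding N_def by (rule Least_le) (use that in auto)
  have "hit_time T A x = enat N"
    unfolding hit_time_def using N N_le by (intro antisym INF_lower INF_greatest) auto
  moreover have "N = k \<longleftrightarrow> 1 \<le> k \<and> (T ^^ k) x \<in> A \<and> (\<forall>j\<in>{1..<k}. (T ^^ j) x \<notin> A)"
  proof
    assume "N = k"
    then show "1 \<le> k \<and> (T ^^ k) x \<in> A \<and> (\<forall>j\<in>{1..<k}. (T ^^ j) x \<notin> A)"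
      using N N_le by (meson atLeastLessThan_iff linorder_not_le)
  next
    assume k: "1 \<le> k \<and> (T ^^ k) x \<in> A \<and> (\<forall>j\<in>{1..<k}. (T ^^ j) x \<notin> A)"
    then have "N \<le> k" "N \<notin> {1..<k}"
      using N N_le by auto
    then show "N = k"
      using N by simp
  qed
  ultimately show ?thesis
    by simp
next
  case False
  then have "{n. 1 \<le> n \<and> (T ^^ n) x \<in> A} = {}"
    by blast
  then have "hit_time T A x = \<infinity>"
    by (simp only: hit_time_def image_empty) (simp add: top_enat_def)
  then show ?thesis
    using False by auto
qed

lemma hit_time_ne_0: "hit_time T A x \<noteq> enat 0"
  by (simp add: hit_time_eq_enat_iff)

context ergodic_system
begin

lemma measurable_funpow_T: "T ^^ n \<in> measurable M M"
  by (induction n) (auto intro!: measurable_comp[OF _ measurable_T, unfolded o_def] simp: o_def)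

lemma hit_time_level_sets:
  assumes "A \<in> sets M"
  shows "{x \<in> space M. hit_time T A x = enat k} \<in> sets M"
proof -
  have [measurable]: "A \<in> sets M" "\<And>n. T ^^ n \<in> measurable M M"
    using assms measurable_funpow_T by auto
  show ?thesis
    unfolding hit_time_eq_enat_iff by measurable
qed

lemma measure_vimage_T: "measure M (T -` B \<inter> space M) = measure M B" if "B \<in> sets M"
  using measure_distr[OF measurable_T that] measure_preserving by simp

text \<open>The level set at \<open>Suc k\<close> lies in the preimage under \<open>T\<close> of the
  level set at \<open>k\<close>, and \<open>T\<close> preserves the measure. The index
  \<open>k\<close> must be positive: the level set at 0 is empty, whereas that at 1 may have
  positive measure.\<close>

lemma hit_prob_Suc_le:
  assumes "A \<in> sets M" "1 \<le> k"
  shows "hit_prob M T A (Suc k) \<le> hit_prob M T A k"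
proof -
  let ?E = "\<lambda>k. {x \<in> space M. hit_time T A x = enat k}"
  have "hit_time T A (T x) = enat k" if "hit_time T A x = enat (Suc k)" for x
  proof -
    have "(T ^^ j) (T x) \<notin> A" if "j \<in> {1..<k}" for j
    proof -
      have "(T ^^ Suc j) x \<notin> A"
        using \<open>hit_time T A x = enat (Suc k)\<close> that unfolding hit_time_eq_enat_iff by fastforce
      then show ?thesis
        by (simp add: funpow_swap1)
    qed
    then show ?thesis
      using that assms(2)
      by (auto simp: hit_time_eq_enat_iff funpow_swap1)
  qed
  then have "?E (Suc k) \<subseteq> T -` ?E k \<inter> space M"
    using measurable_space[OF measurable_T] by auto
  then have "measure M (?E (Suc k)) \<le> measure M (T -` ?E k \<inter> space M)"
    using measurable_sets[OF measurable_T hit_time_level_sets[OF assms(1)]]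
    by (intro finite_measure_mono) auto
  then show ?thesis
    unfolding hit_prob_def measure_vimage_T[OF hit_time_level_sets[OF assms(1)]] .
qed

lemma hit_prob_antimono:
  assumes "A \<in> sets M" "1 \<le> j" "j \<le> k"
  shows "hit_prob M T A k \<le> hit_prob M T A j"
  using assms(3)
proof (induction k rule: dec_induct)
  case (step k)
  then show ?case
    using hit_prob_Suc_le[of A k] assms by linarith
qed simp

text \<open>Monotonicity reduces the claim to \<open>k = 1\<close>, where the level set is the
  preimage of \<open>A\<close>. The resulting bound 1 on the normalized probabilities yields both
  the Lipschitz constant and the dominating function used later.\<close>

lemma hit_prob_le_measure:
  assumes "A \<in> sets M" "1 \<le> k"
  shows "hit_prob M T A k \<le> measure M A"
proof -
  have "hit_prob M T A 1 \<le> measure M (T -` A \<inter> space M)"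
    unfolding hit_prob_def hit_time_eq_enat_iff
    using measurable_sets[OF measurable_T assms(1)] by (intro finite_measure_mono) auto
  then show ?thesis
    using hit_prob_antimono[OF assms(1) order_refl assms(2)] measure_vimage_T[OF assms(1)]
    by simp
qed

text \<open>Dividing by the positive measure leaves the integers from 1 to a floor as possible
  hitting times, and the level sets are disjoint. Infinite hitting times are excluded because their
  product with a positive measure is infinite; for negative \<open>t\<close> the function
  \<open>nat\<close> makes the range empty.\<close>

lemma hit_dist_fun_eq_sum:
  assumes "A \<in> sets M" "0 < measure M A"
  shows "hit_dist_fun M T A t = (\<Sum>k\<in>{1..nat \<lfloor>t / measure M A\<rfloor>}. hit_prob M T A k)"
proof -
  let ?E = "\<lambda>k. {x \<in> space M. hit_time T A x = enat k}"
  have "ereal (measure M A) * ereal_of_enat (hit_time T A x) \<le> ereal t \<longleftrightarrow>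
      (\<exists>k\<in>{1..nat \<lfloor>t / measure M A\<rfloor>}. hit_time T A x = enat k)" for x
  proof (cases "hit_time T A x")
    case (enat k)
    then have "1 \<le> k"
      using hit_time_ne_0[of T A x] by (cases k) auto
    have "real k * measure M A \<le> t \<longleftrightarrow> real k \<le> t / measure M A"
      using assms(2) by (simp add: pos_le_divide_eq)
    also have "\<dots> \<longleftrightarrow> k \<le> nat \<lfloor>t / measure M A\<rfloor>"
      using \<open>1 \<le> k\<close> by linarith
    finally show ?thesis
      using enat \<open>1 \<le> k\<close> by (auto simp: mult.commute)
  next
    case infinity
    then show ?thesis
      using assms(2) by simp
  qed
  then have "hit_dist_fun M T A t = measure M (\<Union>k\<in>{1..nat \<lfloor>t / measure M A\<rfloor>}. ?E k)"
    unfolding hit_dist_fun_def by (intro arg_cong[where f = "measure M"]) auto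
  also have "\<dots> = (\<Sum>k\<in>{1..nat \<lfloor>t / measure M A\<rfloor>}. measure M (?E k))"
    using hit_time_level_sets[OF assms(1)]
    by (intro finite_measure_finite_Union) (auto simp: disjoint_family_on_def)
  finally show ?thesis
    by (simp add: hit_prob_def)
qed

section \<open>Approximate Lipschitz continuity and concavity of the distribution function\<close>

context
  fixes A :: "'a set"
  assumes A: "A \<in> sets M" "0 < measure M A"
begin

lemma hit_dist_fun_diff_eq_sum:
  assumes "s \<le> t"
  shows "hit_dist_fun M T A t - hit_dist_fun M T A s =
    (\<Sum>k\<in>{nat \<lfloor>s / measure M A\<rfloor> <.. nat \<lfloor>t / measure M A\<rfloor>}. hit_prob M T A k)"
proof -
  have "nat \<lfloor>s / measure M A\<rfloor> \<le> nat \<lfloor>t / measure M A\<rfloor>"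
    using assms A by (intro nat_mono floor_mono divide_right_mono) auto
  then have "{1..nat \<lfloor>t / measure M A\<rfloor>} =
      {1..nat \<lfloor>s / measure M A\<rfloor>} \<union> {nat \<lfloor>s / measure M A\<rfloor> <.. nat \<lfloor>t / measure M A\<rfloor>}"
    by auto
  then show ?thesis
    unfolding hit_dist_fun_eq_sum[OF A] by (simp add: sum.union_disjoint disjoint_iff)
qed

lemma hit_dist_fun_mono: "hit_dist_fun M T A s \<le> hit_dist_fun M T A t" if "s \<le> t"
proof -
  have "0 \<le> hit_dist_fun M T A t - hit_dist_fun M T A s"
    unfolding hit_dist_fun_diff_eq_sum[OF that] by (auto intro!: sum_nonneg simp: hit_prob_def)
  then show ?thesis by simp
qed

text \<open>No index in the sum for the increment is below \<open>k\<close>, so monotonicity bounds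
  every term by the one at \<open>k\<close>; the number of terms is at most
  \<open>(t - s) / measure M A + 1\<close>.\<close>

lemma hit_dist_fun_diff_le:
  assumes "0 \<le> s" "s \<le> t" "1 \<le> k" "measure M A * k \<le> s + measure M A"
  shows "hit_dist_fun M T A t - hit_dist_fun M T A s
    \<le> (t - s + measure M A) * (hit_prob M T A k / measure M A)"
proof -
  let ?m = "measure M A"
  have "real k \<le> s / ?m + 1"
    using assms(4) A(2) by (simp add: field_simps)
  \<comment> \<open>The sum starts one index past the floor, so \<open>k\<close> may exceed the
    floor by 1. This is the slack \<open>measure M A\<close> in the assumption on
    \<open>k\<close>.\<close>
  then have k: "k \<le> nat \<lfloor>s / ?m\<rfloor> + 1"
    by linarith
  have "hit_dist_fun M T A t - hit_dist_fun M T A s \<le>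
      (\<Sum>j\<in>{nat \<lfloor>s / ?m\<rfloor> <.. nat \<lfloor>t / ?m\<rfloor>}. hit_prob M T A k)"
    unfolding hit_dist_fun_diff_eq_sum[OF assms(2)]
    by (rule sum_mono) (use k assms A in \<open>auto intro!: hit_prob_antimono\<close>)
  also have "\<dots> = real (nat \<lfloor>t / ?m\<rfloor> - nat \<lfloor>s / ?m\<rfloor>) * hit_prob M T A k"
    by simp
  also have "\<dots> \<le> (t / ?m - s / ?m + 1) * hit_prob M T A k"
    using assms A by (intro mult_right_mono nat_floor_diff_le) (auto simp: divide_right_mono hit_prob_def)
  also have "\<dots> = (t - s + ?m) * (hit_prob M T A k / ?m)"
    using A(2) by (simp add: field_simps)
  finally show ?thesis .
qed

text \<open>Mirror image of the upper bound: no index in the sum exceeds \<open>k\<close>, and there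
  are at least \<open>(t - s) / measure M A - 1\<close> terms.\<close>

lemma hit_dist_fun_diff_ge:
  assumes "0 \<le> s" "s \<le> t" "1 \<le> k" "t \<le> measure M A * k"
  shows "(t - s - measure M A) * (hit_prob M T A k / measure M A)
    \<le> hit_dist_fun M T A t - hit_dist_fun M T A s"
proof -
  let ?m = "measure M A"
  have "t / ?m \<le> real k"
    using assms(4) A(2) by (simp add: field_simps)
  then have k: "nat \<lfloor>t / ?m\<rfloor> \<le> k"
    by linarith
  have "(t - s - ?m) * (hit_prob M T A k / ?m) = (t / ?m - s / ?m - 1) * hit_prob M T A k"
    using A(2) by (simp add: field_simps)
  also have "\<dots> \<le> real (nat \<lfloor>t / ?m\<rfloor> - nat \<lfloor>s / ?m\<rfloor>) * hit_prob M T A k"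
    using assms A by (intro mult_right_mono nat_floor_diff_le) (auto simp: divide_right_mono hit_prob_def)
  also have "\<dots> = (\<Sum>j\<in>{nat \<lfloor>s / ?m\<rfloor> <.. nat \<lfloor>t / ?m\<rfloor>}. hit_prob M T A k)"
    by simp
  also have "\<dots> \<le> hit_dist_fun M T A t - hit_dist_fun M T A s"
    unfolding hit_dist_fun_diff_eq_sum[OF assms(2)]
    by (rule sum_mono) (use k assms A in \<open>auto intro!: hit_prob_antimono\<close>)
  finally show ?thesis .
qed

lemma hit_prob_ratio_bounds: "hit_prob M T A k / measure M A \<in> {0..1}" if "1 \<le> k"
  using hit_prob_le_measure[OF A(1) that] A(2) by (simp add: hit_prob_def)

text \<open>Thanks to the slack, index 1 is admissible in the upper bound for every
  \<open>s \<ge> 0\<close>, and its normalized probability is at most 1.\<close>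

lemma hit_dist_fun_diff_le_length:
  assumes "0 \<le> s" "s \<le> t"
  shows "hit_dist_fun M T A t - hit_dist_fun M T A s \<le> t - s + measure M A"
proof -
  have "hit_dist_fun M T A t - hit_dist_fun M T A s
      \<le> (t - s + measure M A) * (hit_prob M T A 1 / measure M A)"
    using hit_dist_fun_diff_le[of s t 1] assms by simp
  also have "\<dots> \<le> (t - s + measure M A) * 1"
    using hit_prob_ratio_bounds[of 1] assms by (intro mult_left_mono) auto
  finally show ?thesis by simp
qed

text \<open>This is concavity up to an error that vanishes with the measure, multiplied out so that
  degenerate intervals are allowed. One hitting probability next to \<open>t\<close> bounds the
  increment to the right from above and the increment to the left from below.\<close>

lemma hit_dist_fun_slope_le_slope:
  assumes "0 \<le> s" "s \<le> t" "t \<le> u"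
  shows "(hit_dist_fun M T A u - hit_dist_fun M T A t) * (t - s)
    \<le> (hit_dist_fun M T A t - hit_dist_fun M T A s) * (u - t) + measure M A * (u - s)"
proof -
  let ?m = "measure M A" and ?H = "hit_dist_fun M T A"
  \<comment> \<open>The first index past \<open>t / measure M A\<close>: its scaled value lies
    between \<open>t\<close> and \<open>t + measure M A\<close>, as the upper and the lower
    increment bound require.\<close>
  define k where "k = nat \<lfloor>t / ?m\<rfloor> + 1"
  define q where "q = hit_prob M T A k / ?m"
  have "t / ?m \<le> real k" "real k \<le> t / ?m + 1"
    using divide_nonneg_pos[of t ?m] assms A(2) by (simp_all add: k_def) linarith
  then have k: "1 \<le> k" "t \<le> ?m * k" "?m * k \<le> t + ?m"
    using A(2) by (simp_all add: k_def field_simps)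
  have q: "0 \<le> q" "q \<le> 1"
    using hit_prob_ratio_bounds[OF k(1)] by (auto simp: q_def)
  have "(?H u - ?H t) * (t - s) \<le> ((u - t + ?m) * q) * (t - s)"
    using hit_dist_fun_diff_le[of t u k] k assms by (intro mult_right_mono) (auto simp: q_def)
  \<comment> \<open>The product is regrouped so that the left increment bound applies; the errors of
    both sides combine to \<open>?m * (u - s) * q\<close>.\<close>
  also have "\<dots> = ((t - s - ?m) * q) * (u - t) + ?m * (u - s) * q"
    by (simp add: algebra_simps)
  also have "((t - s - ?m) * q) * (u - t) \<le> (?H t - ?H s) * (u - t)"
    using hit_dist_fun_diff_ge[of s t k] k assms by (intro mult_right_mono) (auto simp: q_def)
  also have "?m * (u - s) * q \<le> ?m * (u - s)"
    using q assms by (simp add: mult_left_le)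
  finally show ?thesis by simp
qed

end

end

section \<open>Shrinking targets\<close>

text \<open>Right continuity can then transport estimates from points outside a countable
  exceptional set, below the set of discontinuities of \<open>F\<close>, to all points.\<close>

lemma right_approximation_avoiding_countable:
  fixes t :: real
  assumes "countable N"
  obtains u :: "nat \<Rightarrow> real"
  where "\<And>n. t < u n" "\<And>n. u n \<notin> N" "filterlim u (at_right t) sequentially"
proof -
  have "\<exists>u. t < u \<and> u < t + 1 / real (Suc n) \<and> u \<notin> N" for n
    using real_interval_avoid_countable_set[of t "t + 1 / real (Suc n)" N] assms by auto
  then obtain u where u: "\<And>n. t < u n" "\<And>n. u n < t + 1 / real (Suc n)" "\<And>n. u n \<notin> N"
    by metis
  have "(\<lambda>n. t + 1 / real (Suc n)) \<longlonglongrightarrow> t + 0"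
    by (intro tendsto_intros LIMSEQ_Suc lim_1_over_n)
  then have "u \<longlonglongrightarrow> t"
    using u by (intro tendsto_sandwich[of "\<lambda>_. t" u sequentially "\<lambda>n. t + 1 / real (Suc n)"])
      (auto intro!: always_eventually less_imp_le)
  then have "filterlim u (at_right t) sequentially"
    using u(1) by (auto simp: filterlim_at intro!: always_eventually)
  then show ?thesis
    using u that by blast
qed

text \<open>The induction adds one cell of length \<open>m\<close> at a time. The cells are open on
  the left and closed on the right because these are the level sets of the ceiling.\<close>

lemma has_bochner_integral_step_function:
  fixes p :: "nat \<Rightarrow> real"
  assumes "0 < m"
  shows "has_bochner_integral lborel (\<lambda>s. indicator {0<..m * real n} s * p (nat \<lceil>s / m\<rceil>))
    (\<Sum>k\<in>{1..n}. m * p k)"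
proof (induction n)
  case 0
  then show ?case by (simp add: has_bochner_integral_zero)
next
  case (Suc n)
  let ?I = "{m * real n <.. m * real (Suc n)}"
  have "has_bochner_integral lborel (indicator ?I) (measure lborel ?I)"
    using assms by (intro has_bochner_integral_real_indicator) auto
  then have "has_bochner_integral lborel (\<lambda>s. indicator ?I s * p (Suc n)) (measure lborel ?I * p (Suc n))"
    by (rule has_bochner_integral_mult_left)
  moreover have "measure lborel ?I = m"
    using assms by (simp add: algebra_simps)
  moreover have "nat \<lceil>s / m\<rceil> = Suc n" if "s \<in> ?I" for s
  proof -
    have "real n < s / m" "s / m \<le> real n + 1"
      using that assms by (auto simp: field_simps)
    then have "\<lceil>s / m\<rceil> = int n + 1"
      by (intro ceiling_unique) auto
    then show ?thesis by simp
  qed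
  moreover have "indicator {0<..m * real (Suc n)} s = (indicator {0<..m * real n} s + indicator ?I s :: real)" for s
  proof -
    have "0 \<le> m * real n" "m * real n \<le> m * real (Suc n)"
      using assms by auto
    then show ?thesis
      by (auto simp: indicator_def)
  qed
  ultimately have "(\<lambda>s. indicator {0<..m * real n} s * p (nat \<lceil>s / m\<rceil>) + indicator ?I s * p (Suc n)) =
      (\<lambda>s. indicator {0<..m * real (Suc n)} s * p (nat \<lceil>s / m\<rceil>))"
    and "has_bochner_integral lborel (\<lambda>s. indicator ?I s * p (Suc n)) (m * p (Suc n))"
    by (auto simp: fun_eq_iff algebra_simps indicator_def)
  then show ?case
    using has_bochner_integral_add[OF Suc] by force
qed

locale shrinking_targets = ergodic_system M T
  for M :: "'a measure" and T +
  fixes A :: "nat \<Rightarrow> 'a set"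
  assumes A_sets: "\<And>l. 1 \<le> l \<Longrightarrow> A l \<in> sets M"
    and A_pos: "\<And>l. 1 \<le> l \<Longrightarrow> 0 < measure M (A l)"
    and A_lim: "(\<lambda>l. measure M (A l)) \<longlonglongrightarrow> 0"
begin

abbreviation m :: "nat \<Rightarrow> real" where
  "m l \<equiv> measure M (A l)"

abbreviation H :: "nat \<Rightarrow> real \<Rightarrow> real" where
  "H l \<equiv> hit_dist_fun M T (A l)"

abbreviation q :: "nat \<Rightarrow> nat \<Rightarrow> real" where
  "q l k \<equiv> hit_prob M T (A l) k / measure M (A l)"

text \<open>Convergence is required at the two endpoints only, so that the bounds are available
  between continuity points of \<open>F\<close> before convergence everywhere is known.\<close>

lemma limit_increment:
  assumes "0 \<le> s" "s \<le> t" "(\<lambda>l. H l s) \<longlonglongrightarrow> F s" "(\<lambda>l. H l t) \<longlonglongrightarrow> F t"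
  shows "F s \<le> F t" and "F t - F s \<le> t - s"
proof -
  have "\<forall>\<^sub>F l in sequentially. H l s \<le> H l t"
    using eventually_ge_at_top[of 1] by eventually_elim (use assms hit_dist_fun_mono A_sets A_pos in auto)
  then show "F s \<le> F t"
    using assms tendsto_le sequentially_bot by blast
  have "\<forall>\<^sub>F l in sequentially. H l t - H l s \<le> t - s + m l"
    using eventually_ge_at_top[of 1]
    by eventually_elim (use assms hit_dist_fun_diff_le_length A_sets A_pos in auto)
  moreover have "(\<lambda>l. H l t - H l s) \<longlonglongrightarrow> F t - F s" "(\<lambda>l. t - s + m l) \<longlonglongrightarrow> t - s + 0"
    by (intro tendsto_intros assms A_lim)+
  ultimately show "F t - F s \<le> t - s"
    using tendsto_le[OF sequentially_bot] by fastforce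
qed

text \<open>The approximate Lipschitz and concavity inequalities pass to the limit, as their error
  terms are fixed multiples of \<open>m l\<close>.\<close>

lemma limit_concave_lipschitz:
  assumes lim: "\<And>t. 0 \<le> t \<Longrightarrow> (\<lambda>l. H l t) \<longlonglongrightarrow> F t"
  shows "concave_lipschitz F 1"
proof
  show "1-lipschitz_on {0..} F"
  proof (rule lipschitz_on_leI)
    fix s t :: real assume "s \<in> {0..}" "t \<in> {0..}" "s \<le> t"
    then show "dist (F s) (F t) \<le> 1 * dist s t"
      using limit_increment[of s t F] lim by (auto simp: dist_real_def)
  qed simp
  show "concave_on {0..} F"
  proof (rule concave_on_linorderI)
    fix r s u :: real
    assume r: "0 < r" "r < 1" and su: "s \<in> {0..}" "u \<in> {0..}" "s < u"
    define t where "t = (1 - r) *\<^sub>R s + r *\<^sub>R u"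
    have ts: "t - s = r * (u - s)" "u - t = (1 - r) * (u - s)"
      by (simp_all add: t_def algebra_simps)
    have "0 \<le> t - s" "0 \<le> u - t"
      unfolding ts using r su by auto
    then have t: "s \<le> t" "t \<le> u"
      by auto
    have "\<forall>\<^sub>F l in sequentially. (H l u - H l t) * (t - s) \<le> (H l t - H l s) * (u - t) + m l * (u - s)"
      using eventually_ge_at_top[of 1]
      by eventually_elim (use su t hit_dist_fun_slope_le_slope A_sets A_pos in auto)
    moreover have "(\<lambda>l. (H l u - H l t) * (t - s)) \<longlonglongrightarrow> (F u - F t) * (t - s)"
      "(\<lambda>l. (H l t - H l s) * (u - t) + m l * (u - s)) \<longlonglongrightarrow> (F t - F s) * (u - t) + 0 * (u - s)"
      using su t by (intro tendsto_intros lim A_lim; simp)+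
    ultimately have "(F u - F t) * (t - s) \<le> (F t - F s) * (u - t) + 0 * (u - s)"
      using tendsto_le[OF sequentially_bot] by blast
    then have "((F u - F t) * r) * (u - s) \<le> ((F t - F s) * (1 - r)) * (u - s)"
      by (simp only: ts mult_zero_left add_0_right mult.assoc)
    then have "(F u - F t) * r \<le> (F t - F s) * (1 - r)"
      using su by (simp only: mult_le_cancel_right)
    then show "(1 - r) * F s + r * F u \<le> F ((1 - r) *\<^sub>R s + r *\<^sub>R u)"
      unfolding t_def[symmetric] by (simp add: algebra_simps)
  qed simp
qed

text \<open>Weak convergence gives pointwise limits outside the countable set \<open>N\<close> of
  discontinuities. Increment bounds between points outside \<open>N\<close> extend to all points by
  right continuity, so \<open>F\<close> is 1-Lipschitz and \<open>N\<close> is empty. Conversely, a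
  pointwise limit inherits all properties required of \<open>F\<close>.\<close>

lemma hit_times_converge_iff:
  "hit_times_converge M T A F \<longleftrightarrow> (\<forall>t\<ge>0. (\<lambda>l. H l t) \<longlonglongrightarrow> F t)"
proof
  assume conv: "hit_times_converge M T A F"
  define N where "N = {t\<in>{0..}. \<not> continuous (at t within {0..}) F}"
  have weak: "(\<lambda>l. H l t) \<longlonglongrightarrow> F t" if "0 \<le> t" "t \<notin> N" for t
    using conv that by (auto simp: hit_times_converge_def weak_conv_nonneg_def N_def)
  have F: "mono_on {0..} F" "\<And>t. 0 \<le> t \<Longrightarrow> (F \<longlongrightarrow> F t) (at_right t)"
    using conv by (auto simp: hit_times_converge_def subprob_dist_fun_def continuous_within)
  have "countable N"
    unfolding N_def by (rule mono_on_ctble_discont[OF F(1)])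
  have "F t - F s \<le> t - s" if st: "0 \<le> s" "s < t" for s t
  proof -
    obtain u where u: "\<And>n. s < u n" "\<And>n. u n \<notin> N" "filterlim u (at_right s) sequentially"
      using right_approximation_avoiding_countable[OF \<open>countable N\<close>, of s] by blast
    obtain v where v: "\<And>n. t < v n" "\<And>n. v n \<notin> N" "filterlim v (at_right t) sequentially"
      using right_approximation_avoiding_countable[OF \<open>countable N\<close>, of t] by blast
    have uv: "u \<longlonglongrightarrow> s" "v \<longlonglongrightarrow> t"
      using u v by (auto simp: filterlim_at)
    \<comment> \<open>This puts \<open>u n\<close> to the left of \<open>v n\<close>, so that the
      increment bound applies between them.\<close>
    have "\<forall>\<^sub>F n in sequentially. u n < t"
      using order_tendstoD(2)[OF uv(1) st(2)] .
    then have "\<forall>\<^sub>F n in sequentially. F (v n) - F (u n) \<le> v n - u n"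
    proof eventually_elim
      case (elim n)
      then show ?case
        using u(1)[of n] v(1)[of n] st
        by (intro limit_increment(2)) (auto intro!: weak u v)
    qed
    moreover have "(\<lambda>n. F (v n) - F (u n)) \<longlonglongrightarrow> F t - F s" "(\<lambda>n. v n - u n) \<longlonglongrightarrow> t - s"
      using st uv
      by (auto intro!: tendsto_intros filterlim_compose[OF F(2) u(3)] filterlim_compose[OF F(2) v(3)])
    ultimately show ?thesis
      using tendsto_le[OF sequentially_bot] by blast
  qed
  then have "1-lipschitz_on {0..} F"
    using mono_onD[OF F(1)]
    by (intro lipschitz_on_leI) (auto simp: dist_real_def abs_le_iff order_le_less)
  then have "N = {}"
    using lipschitz_on_continuous_within unfolding N_def by blast
  then show "\<forall>t\<ge>0. (\<lambda>l. H l t) \<longlonglongrightarrow> F t"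
    using weak by simp
next
  assume lim: "\<forall>t\<ge>0. (\<lambda>l. H l t) \<longlonglongrightarrow> F t"
  then interpret concave_lipschitz F 1
    by (intro limit_concave_lipschitz) auto
  have "continuous (at_right t) F" if "0 \<le> t" for t
  proof (rule continuous_within_subset)
    show "continuous (at t within {0..}) F"
      using continuous_on_nonneg that by (simp add: continuous_on_eq_continuous_within)
  qed (use that in auto)
  moreover have "mono_on {0..} F"
    using limit_increment(1) lim by (intro mono_onI) auto
  moreover have "0 \<le> F t" "F t \<le> 1" if "0 \<le> t" for t
    using LIMSEQ_le_const[of "\<lambda>l. H l t" "F t" 0] LIMSEQ_le_const2[of "\<lambda>l. H l t" "F t" 1] lim that
    by (auto simp: hit_dist_fun_def)
  ultimately show "hit_times_converge M T A F"
    using lim by (auto simp: hit_times_converge_def subprob_dist_fun_def weak_conv_nonneg_def)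
qed

section \<open>From convergence of hitting times to asymptotics of hitting probabilities\<close>

lemma hit_times_converge_imp_concave_lipschitz:
  "hit_times_converge M T A F \<Longrightarrow> concave_lipschitz F 1"
  by (auto simp: hit_times_converge_iff intro: limit_concave_lipschitz)

text \<open>For \<open>m l * real k\<close> within \<open>\<delta>\<close> of \<open>t\<close>, the
  ratio \<open>q l k\<close> is squeezed between increments of \<open>H l\<close> over
  \<open>{t + \<delta>..t + 2 * \<delta>}\<close> and over
  \<open>{t - 2 * \<delta>..t - \<delta>}\<close>, divided by \<open>\<delta> + m l\<close> and
  \<open>\<delta> - m l\<close>. These intervals do not depend on \<open>k\<close>, whence the
  uniformity.\<close>

lemma hit_prob_locally_uniform:
  assumes conv: "hit_times_converge M T A F"
    and t: "0 < t" "isCont (rc_deriv F) t" and "0 < \<epsilon>"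
  obtains \<delta> where "0 < \<delta>"
    "\<forall>\<^sub>F l in sequentially. \<forall>k\<ge>1. \<bar>m l * real k - t\<bar> < \<delta> \<longrightarrow> \<bar>q l k - rc_deriv F t\<bar> < \<epsilon>"
proof -
  interpret concave_lipschitz F 1
    by (rule hit_times_converge_imp_concave_lipschitz[OF conv])
  have lim: "\<And>t. 0 \<le> t \<Longrightarrow> (\<lambda>l. H l t) \<longlonglongrightarrow> F t"
    using conv by (simp add: hit_times_converge_iff)
  obtain r where r: "0 < r" "\<And>s. \<bar>s - t\<bar> < r \<Longrightarrow> \<bar>rc_deriv F s - rc_deriv F t\<bar> < \<epsilon>"
    using t(2) \<open>0 < \<epsilon>\<close> unfolding continuous_at_eps_delta dist_real_def by blast
  \<comment> \<open>All four endpoints \<open>t - 2 * \<delta>\<close>, ...,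
    \<open>t + 2 * \<delta>\<close> are then positive and within \<open>r\<close> of
    \<open>t\<close>.\<close>
  define \<delta> where "\<delta> = min r t / 3"
  have \<delta>: "0 < \<delta>" "2 * \<delta> < r" "2 * \<delta> < t"
    using r(1) t(1) by (auto simp: \<delta>_def)
  have "(F (t + 2 * \<delta>) - F (t + \<delta>)) / \<delta> \<ge> rc_deriv F (t + 2 * \<delta>)"
    using rc_deriv_le_slope[of "t + \<delta>" "t + 2 * \<delta>"] \<delta> t by simp
  moreover have "\<bar>rc_deriv F (t + 2 * \<delta>) - rc_deriv F t\<bar> < \<epsilon>"
    using \<delta> by (intro r) auto
  \<comment> \<open>The summand 0 is kept to match the limit of the denominators
    \<open>\<delta> + m l\<close>.\<close>
  ultimately have "rc_deriv F t - \<epsilon> < (F (t + 2 * \<delta>) - F (t + \<delta>)) / (\<delta> + 0)"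
    by simp
  moreover have "(\<lambda>l. (H l (t + 2 * \<delta>) - H l (t + \<delta>)) / (\<delta> + m l))
      \<longlonglongrightarrow> (F (t + 2 * \<delta>) - F (t + \<delta>)) / (\<delta> + 0)"
    using \<delta> t by (intro tendsto_intros lim A_lim) auto
  ultimately have lower: "\<forall>\<^sub>F l in sequentially.
      rc_deriv F t - \<epsilon> < (H l (t + 2 * \<delta>) - H l (t + \<delta>)) / (\<delta> + m l)"
    using order_tendstoD(1) by blast
  have "(F (t - \<delta>) - F (t - 2 * \<delta>)) / \<delta> \<le> rc_deriv F (t - 2 * \<delta>)"
    using slope_le_rc_deriv[of "t - 2 * \<delta>" "t - \<delta>"] \<delta> t by simp
  moreover have "\<bar>rc_deriv F (t - 2 * \<delta>) - rc_deriv F t\<bar> < \<epsilon>"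
    using \<delta> by (intro r) auto
  ultimately have "(F (t - \<delta>) - F (t - 2 * \<delta>)) / (\<delta> - 0) < rc_deriv F t + \<epsilon>"
    by simp
  moreover have "(\<lambda>l. (H l (t - \<delta>) - H l (t - 2 * \<delta>)) / (\<delta> - m l))
      \<longlonglongrightarrow> (F (t - \<delta>) - F (t - 2 * \<delta>)) / (\<delta> - 0)"
    using \<delta> t by (intro tendsto_intros lim A_lim) auto
  ultimately have upper: "\<forall>\<^sub>F l in sequentially.
      (H l (t - \<delta>) - H l (t - 2 * \<delta>)) / (\<delta> - m l) < rc_deriv F t + \<epsilon>"
    using order_tendstoD(2) by blast
  \<comment> \<open>This makes the denominator \<open>\<delta> - m l\<close> of the upper bound
    positive.\<close>
  have "\<forall>\<^sub>F l in sequentially. m l < \<delta>"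
    using order_tendstoD(2)[OF A_lim \<delta>(1)] .
  then have "\<forall>\<^sub>F l in sequentially. \<forall>k\<ge>1. \<bar>m l * real k - t\<bar> < \<delta> \<longrightarrow> \<bar>q l k - rc_deriv F t\<bar> < \<epsilon>"
    using eventually_ge_at_top[of 1] lower upper
  proof eventually_elim
    case (elim l)
    note A = A_sets[OF elim(2)] A_pos[OF elim(2)]
    show ?case
    proof (intro allI impI)
      fix k :: nat assume k: "1 \<le> k" "\<bar>m l * real k - t\<bar> < \<delta>"
      have "H l (t + 2 * \<delta>) - H l (t + \<delta>) \<le> (\<delta> + m l) * q l k"
        using hit_dist_fun_diff_le[OF A, of "t + \<delta>" "t + 2 * \<delta>" k] k \<delta> t A by simp
      then have "(H l (t + 2 * \<delta>) - H l (t + \<delta>)) / (\<delta> + m l) \<le> q l k"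
        using \<delta> A(2) by (simp add: pos_divide_le_eq mult.commute)
      moreover have "(\<delta> - m l) * q l k \<le> H l (t - \<delta>) - H l (t - 2 * \<delta>)"
        using hit_dist_fun_diff_ge[OF A, of "t - 2 * \<delta>" "t - \<delta>" k] k \<delta> t A by simp
      then have "q l k \<le> (H l (t - \<delta>) - H l (t - 2 * \<delta>)) / (\<delta> - m l)"
        using elim(1) by (simp add: pos_le_divide_eq mult.commute)
      ultimately show "\<bar>q l k - rc_deriv F t\<bar> < \<epsilon>"
        using elim by linarith
    qed
  qed
  then show ?thesis
    using \<delta>(1) that by blast
qed

text \<open>Near each \<open>t\<close> in \<open>J\<close> both \<open>q l k\<close> and the
  derivative at \<open>m l * real k\<close> are close to the positive number
  \<open>rc_deriv F t\<close>, so their ratio is close to 1. Finitely many such neighbourhoods cover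
  \<open>J\<close>, and finitely many eventual statements hold simultaneously.\<close>

lemma hit_prob_uniform_on_compact:
  assumes conv: "hit_times_converge M T A F"
    and J: "compact J" "J \<subseteq> {0<..}"
      "\<And>t. t \<in> J \<Longrightarrow> isCont (rc_deriv F) t" "\<And>t. t \<in> J \<Longrightarrow> 0 < rc_deriv F t"
    and "0 < \<epsilon>"
  shows "\<forall>\<^sub>F l in sequentially. \<forall>k\<ge>1. m l * real k \<in> J \<longrightarrow> \<bar>q l k / rc_deriv F (m l * real k) - 1\<bar> < \<epsilon>"
proof -
  let ?f = "rc_deriv F"
  let ?P = "\<lambda>t \<delta>. 0 < \<delta> \<and> (\<forall>\<^sub>F l in sequentially. \<forall>k\<ge>1. \<bar>m l * real k - t\<bar> < \<delta> \<longrightarrow>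
    \<bar>q l k / ?f (m l * real k) - 1\<bar> < \<epsilon>)"
  have "\<exists>\<delta>. ?P t \<delta>" if tJ: "t \<in> J" for t
  proof -
    \<comment> \<open>The first bound keeps the denominator above \<open>?f t / 2\<close>; the
      second makes the difference of numerator and denominator, less than \<open>2 * \<eta>\<close>,
      small relative to it.\<close>
    define \<eta> where "\<eta> = min (?f t / 2) (\<epsilon> * ?f t / 4)"
    have \<eta>: "0 < \<eta>" "\<eta> \<le> ?f t / 2" "2 * \<eta> \<le> \<epsilon> * (?f t / 2)"
      using J(4)[OF tJ] \<open>0 < \<epsilon>\<close> by (auto simp: \<eta>_def)
    have "0 < t"
      using tJ J by auto
    from hit_prob_locally_uniform[OF conv this J(3)[OF tJ] \<eta>(1)]
    obtain \<delta> where \<delta>: "0 < \<delta>"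
      "\<forall>\<^sub>F l in sequentially. \<forall>k\<ge>1. \<bar>m l * real k - t\<bar> < \<delta> \<longrightarrow> \<bar>q l k - ?f t\<bar> < \<eta>"
      by blast
    obtain r where r: "0 < r" "\<And>s. \<bar>s - t\<bar> < r \<Longrightarrow> \<bar>?f s - ?f t\<bar> < \<eta>"
      using J(3)[OF tJ] \<eta>(1) unfolding continuous_at_eps_delta dist_real_def by blast
    have ratio: "\<bar>x / y - 1\<bar> < \<epsilon>" if "\<bar>x - ?f t\<bar> < \<eta>" "\<bar>y - ?f t\<bar> < \<eta>" for x y
    proof -
      have y: "?f t / 2 < y"
        using that \<eta> by linarith
      then have "0 < y"
        using J(4)[OF tJ] by linarith
      have "\<bar>x - y\<bar> < 2 * \<eta>"
        using that by linarith
      also have "\<dots> \<le> \<epsilon> * (?f t / 2)"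
        by fact
      also have "\<dots> \<le> \<epsilon> * y"
        using y \<open>0 < \<epsilon>\<close> by (intro mult_left_mono) auto
      finally have "\<bar>x - y\<bar> / y < \<epsilon>"
        using \<open>0 < y\<close> by (simp add: pos_divide_less_eq)
      moreover have "x / y - 1 = (x - y) / y"
        using \<open>0 < y\<close> by (simp add: diff_divide_distrib)
      ultimately show ?thesis
        using \<open>0 < y\<close> by (simp add: abs_divide)
    qed
    have "\<forall>\<^sub>F l in sequentially. \<forall>k\<ge>1. \<bar>m l * real k - t\<bar> < min \<delta> r \<longrightarrow>
        \<bar>q l k / ?f (m l * real k) - 1\<bar> < \<epsilon>"
      using \<delta>(2)
    proof eventually_elim
      case (elim l)
      show ?case
      proof (intro allI impI)
        fix k :: nat assume "1 \<le> k" "\<bar>m l * real k - t\<bar> < min \<delta> r"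
        then show "\<bar>q l k / ?f (m l * real k) - 1\<bar> < \<epsilon>"
          using elim r(2) by (intro ratio) simp_all
      qed
    qed
    then show ?thesis
      using \<delta>(1) r(1) by (intro exI[of _ "min \<delta> r"]) simp
  qed
  then have "\<exists>d. \<forall>t\<in>J. ?P t (d t)"
    by (intro bchoice ballI)
  then obtain d where d: "\<forall>t\<in>J. ?P t (d t)"
    by (elim exE)
  have d_pos: "0 < d t" if "t \<in> J" for t
    by (rule conjunct1[OF bspec[OF d that]])
  have d_ev: "\<forall>\<^sub>F l in sequentially. \<forall>k\<ge>1. \<bar>m l * real k - t\<bar> < d t \<longrightarrow>
      \<bar>q l k / ?f (m l * real k) - 1\<bar> < \<epsilon>" if "t \<in> J" for t
    by (rule conjunct2[OF bspec[OF d that]])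
  have "J \<subseteq> (\<Union>t\<in>J. ball t (d t))"
    using d_pos by auto
  then obtain C where C: "C \<subseteq> J" "finite C" "J \<subseteq> (\<Union>t\<in>C. ball t (d t))"
    by (rule compactE_image[OF J(1) open_ball])
  have "\<forall>\<^sub>F l in sequentially. \<forall>t\<in>C. \<forall>k\<ge>1. \<bar>m l * real k - t\<bar> < d t \<longrightarrow>
      \<bar>q l k / ?f (m l * real k) - 1\<bar> < \<epsilon>"
    using C(1) by (intro eventually_ball_finite[OF C(2)] ballI d_ev) (rule subsetD)
  then show ?thesis
  proof eventually_elim
    case (elim l)
    show ?case
    proof (intro allI impI)
      fix k assume k: "1 \<le> k" "m l * real k \<in> J"
      then obtain t where "t \<in> C" "m l * real k \<in> ball t (d t)"
        using C(3) by blast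
      then have "t \<in> C" "\<bar>m l * real k - t\<bar> < d t"
        by (simp_all add: dist_real_def abs_minus_commute)
      then show "\<bar>q l k / ?f (m l * real k) - 1\<bar> < \<epsilon>"
        using elim k(1) by blast
    qed
  qed
qed

section \<open>From asymptotics of hitting probabilities to convergence of hitting times\<close>

lemma hit_dist_fun_eq_integral:
  assumes "1 \<le> l" "N = nat \<lfloor>t / m l\<rfloor>"
  shows "H l t = (LINT s|lborel. indicator {0<..m l * real N} s * q l (nat \<lceil>s / m l\<rceil>))"
proof -
  note A = A_sets[OF assms(1)] A_pos[OF assms(1)]
  have "(LINT s|lborel. indicator {0<..m l * real N} s * q l (nat \<lceil>s / m l\<rceil>)) = (\<Sum>k\<in>{1..N}. m l * q l k)"
    using has_bochner_integral_step_function[OF A(2)] by (rule has_bochner_integral_integral_eq)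
  then show ?thesis
    using hit_dist_fun_eq_sum[OF A] A(2) by (simp add: assms(2))
qed

text \<open>Dominated convergence for the step functions \<open>?u\<close>: they are bounded by the
  indicator of \<open>{0<..t}\<close> and converge to \<open>?v\<close> off a null set.
  Integrability of the limit comes from the same argument.\<close>

lemma hit_dist_fun_tendsto_integral:
  fixes D :: "real set" and G :: "real \<Rightarrow> real"
  assumes D: "D \<in> sets borel" "D \<subseteq> {0<..}" "emeasure lborel ({0<..} - D) = 0"
    and G: "\<And>s. s \<in> D \<Longrightarrow> (\<lambda>l. q l (nat \<lceil>s / m l\<rceil>)) \<longlonglongrightarrow> G s"
    and "0 \<le> t"
  shows "set_integrable lborel (D \<inter> {0..t}) G"
    and "(\<lambda>l. H l t) \<longlonglongrightarrow> (LINT s:D \<inter> {0..t}|lborel. G s)"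
proof -
  define N where "N l = nat \<lfloor>t / m l\<rfloor>" for l
  define g where "g l s = q l (nat \<lceil>s / m l\<rceil>)" for l s
  let ?u = "\<lambda>l s. indicator {0<..m l * real (N l)} s * g l s"
  let ?v = "\<lambda>s. indicator (D \<inter> {0..t}) s * G s"
  have [measurable]: "D \<in> sets borel" by fact
  have g_meas [measurable]: "g l \<in> borel_measurable borel" for l
    unfolding g_def by measurable
  \<comment> \<open>With the indicator of \<open>D\<close> as a factor the convergence holds at
    every point, so that \<open>?v\<close> is measurable as a pointwise limit; \<open>G\<close> is
    controlled on \<open>D\<close> only.\<close>
  have lim_D: "(\<lambda>l. indicator (D \<inter> {0..t}) s * g l s) \<longlonglongrightarrow> ?v s" for s
  proof (cases "s \<in> D")
    case True
    then show ?thesis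
      unfolding g_def by (intro tendsto_mult tendsto_const G)
  qed auto
  then have v_meas: "?v \<in> borel_measurable borel"
    by (rule borel_measurable_LIMSEQ_real) measurable
  have N: "m l * real (N l) \<le> t" "t - m l < m l * real (N l)" if "1 \<le> l" for l
  proof -
    have "0 \<le> t / m l"
      using \<open>0 \<le> t\<close> by simp
    then have "real (N l) \<le> t / m l" "t / m l < real (N l) + 1"
      unfolding N_def by linarith+
    then show "m l * real (N l) \<le> t" "t - m l < m l * real (N l)"
      using A_pos[OF that] by (simp_all add: field_simps)
  qed
  \<comment> \<open>The bound is available for indices from 1 on, whereas dominated convergence asks
    for it at all indices; hence the shift, undone at the end.\<close>
  have bound: "\<bar>?u (Suc l) s\<bar> \<le> indicator {0<..t} s" for l s
  proof (cases "s \<in> {0<..m (Suc l) * real (N (Suc l))}")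
    case True
    then have "0 < s / m (Suc l)" "s \<le> t"
      using A_pos[of "Suc l"] N(1)[of "Suc l"] by auto
    then have "1 \<le> nat \<lceil>s / m (Suc l)\<rceil>"
      by linarith
    then have "g (Suc l) s \<in> {0..1}"
      unfolding g_def using hit_prob_ratio_bounds[OF A_sets A_pos] by simp
    then show ?thesis
      using True \<open>s \<le> t\<close> by (simp add: indicator_def)
  qed auto
  \<comment> \<open>The cells end at \<open>m l * real (N l)\<close>, which lies in
    \<open>{t - m l<..t}\<close>. Whether \<open>t\<close> itself is covered may vary with
    \<open>l\<close>, so this single point is left out.\<close>
  have lim: "(\<lambda>l. ?u l s) \<longlonglongrightarrow> ?v s" if s: "s \<notin> {0<..} - D" "s \<noteq> t" for s
  proof -
    consider "s \<le> 0" | "s \<in> D" "s < t" | "s \<in> D" "t < s"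
      using s by force
    then have "\<forall>\<^sub>F l in sequentially. indicator (D \<inter> {0..t}) s * g l s = ?u l s"
    proof cases
      case 1
      then show ?thesis
        using D(2) by (auto simp: indicator_def)
    next
      case 2
      then have "\<forall>\<^sub>F l in sequentially. m l < t - s"
        using order_tendstoD(2)[OF A_lim] by simp
      then show ?thesis
        using eventually_ge_at_top[of 1]
      proof eventually_elim
        case (elim l)
        then have "s \<le> m l * real (N l)"
          using N(2)[of l] by linarith
        then show ?case
          using 2 D(2) by (auto simp: indicator_def)
      qed
    next
      case 3
      show ?thesis
        using eventually_ge_at_top[of 1]
      proof eventually_elim
        case (elim l)
        then have "m l * real (N l) < s"
          using N(1)[of l] 3 by linarith
        then show ?case
          using 3 by (auto simp: indicator_def)
      qed
    qed
    with lim_D show ?thesis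
      by (rule Lim_transform_eventually)
  qed
  have null: "{0<..} - D \<in> null_sets lborel"
    using D by auto
  have AE: "AE s in lborel. (\<lambda>l. ?u (Suc l) s) \<longlonglongrightarrow> ?v s"
    using AE_lborel_singleton[of t] AE_not_in[OF null]
  proof eventually_elim
    case (elim s)
    then show ?case
      by (intro LIMSEQ_Suc lim) auto
  qed
  have w: "integrable lborel (indicator {0<..t} :: real \<Rightarrow> real)"
    using \<open>0 \<le> t\<close> by (intro integrable_real_indicator) auto
  have u_meas: "?u (Suc l) \<in> borel_measurable lborel" for l
    by measurable
  have v_meas': "?v \<in> borel_measurable lborel"
    using v_meas by simp
  have bound': "AE s in lborel. norm (?u (Suc l) s) \<le> indicator {0<..t} s" for l
    using bound by simp
  show "set_integrable lborel (D \<inter> {0..t}) G"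
    using integrable_dominated_convergence[OF v_meas' u_meas w AE bound']
    by (simp add: set_integrable_def)
  have "(\<lambda>l. LINT s|lborel. ?u (Suc l) s) \<longlonglongrightarrow> (LINT s|lborel. ?v s)"
    by (rule integral_dominated_convergence[OF v_meas' u_meas w AE bound'])
  then have "(\<lambda>l. H (Suc l) t) \<longlonglongrightarrow> (LINT s:D \<inter> {0..t}|lborel. G s)"
    using hit_dist_fun_eq_integral[OF _ N_def]
    by (simp add: g_def set_lebesgue_integral_def)
  then show "(\<lambda>l. H l t) \<longlonglongrightarrow> (LINT s:D \<inter> {0..t}|lborel. G s)"
    by (rule LIMSEQ_imp_Suc)
qed

text \<open>The index of the cell containing \<open>s\<close> is an admissible sequence for the
  hypothesis of (b), which thereby yields the pointwise limit of the step functions.\<close>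

lemma ceiling_seq:
  assumes "0 < s"
  defines "k \<equiv> \<lambda>l. nat \<lceil>s / m l\<rceil>"
  shows "k \<in> pos_seqs" and "(\<lambda>l. m l * real (k l)) \<longlonglongrightarrow> s"
proof -
  have k: "1 \<le> k l" "s \<le> m l * real (k l)" "m l * real (k l) \<le> s + m l" if "1 \<le> l" for l
  proof -
    have pos: "0 < s / m l"
      using A_pos[OF that] assms(1) by simp
    then show "1 \<le> k l"
      unfolding k_def by linarith
    have "s / m l \<le> real (k l)" "real (k l) \<le> s / m l + 1"
      unfolding k_def using pos by linarith+
    then show "s \<le> m l * real (k l)" "m l * real (k l) \<le> s + m l"
      using A_pos[OF that] by (simp_all add: field_simps)
  qed
  then show "k \<in> pos_seqs"
    by (simp add: pos_seqs_def)
  show "(\<lambda>l. m l * real (k l)) \<longlonglongrightarrow> s"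
  proof (rule tendsto_sandwich)
    show "\<forall>\<^sub>F l in sequentially. s \<le> m l * real (k l)"
      by (rule eventually_sequentiallyI[OF k(2)])
    show "\<forall>\<^sub>F l in sequentially. m l * real (k l) \<le> s + m l"
      by (rule eventually_sequentiallyI[OF k(3)])
    show "(\<lambda>l. s + m l) \<longlonglongrightarrow> s"
      using tendsto_add[OF tendsto_const A_lim] by simp
  qed simp
qed

section \<open>The three assertions for sequences of indices\<close>

lemma sim_const_iff: "sim_const a c m \<longleftrightarrow> (\<lambda>l. a l / m l) \<longlonglongrightarrow> c"
proof -
  have "\<forall>\<^sub>F l in sequentially. 0 < m l"
    by (rule eventually_sequentiallyI[OF A_pos])
  then show ?thesis
    by (simp add: sim_const_def)
qed

lemma sim_const_hit_prob:
  assumes conv: "hit_times_converge M T A F" and k: "k \<in> pos_seqs"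
    and t: "0 < t" "(\<lambda>l. m l * real (k l)) \<longlonglongrightarrow> t" "isCont (rc_deriv F) t"
  shows "sim_const (\<lambda>l. hit_prob M T (A l) (k l)) (rc_deriv F t) m"
  unfolding sim_const_iff
proof (rule tendstoI)
  fix \<epsilon> :: real assume "0 < \<epsilon>"
  from hit_prob_locally_uniform[OF conv t(1,3) this] obtain \<delta> where \<delta>: "0 < \<delta>"
    "\<forall>\<^sub>F l in sequentially. \<forall>k\<ge>1. \<bar>m l * real k - t\<bar> < \<delta> \<longrightarrow> \<bar>q l k - rc_deriv F t\<bar> < \<epsilon>"
    by blast
  show "\<forall>\<^sub>F l in sequentially. dist (q l (k l)) (rc_deriv F t) < \<epsilon>"
    using \<delta>(2) tendstoD[OF t(2) \<delta>(1)] eventually_ge_at_top[of 1]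
    by eventually_elim (use k in \<open>auto simp: dist_real_def pos_seqs_def\<close>)
qed

text \<open>For each \<open>s\<close> in \<open>D\<close> the hypothesis on \<open>G\<close> is
  applied to the ceiling sequence of \<open>s\<close>; the rest is the integral limit.\<close>

lemma hit_times_converge_if_sim_const:
  fixes D :: "real set" and G :: "real \<Rightarrow> real"
  assumes D: "D \<in> sets borel" "D \<subseteq> {0<..}" "emeasure lborel ({0<..} - D) = 0"
    and G: "\<And>k t. k \<in> pos_seqs \<Longrightarrow> t \<in> D \<Longrightarrow> (\<lambda>l. m l * real (k l)) \<longlonglongrightarrow> t \<Longrightarrow>
      sim_const (\<lambda>l. hit_prob M T (A l) (k l)) (G t) m"
  shows "0 < t \<Longrightarrow> set_integrable lborel (D \<inter> {0..t}) G"
    and "hit_times_converge M T A (\<lambda>t. LINT s:D \<inter> {0..t}|lborel. G s)"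
proof -
  have "(\<lambda>l. q l (nat \<lceil>s / m l\<rceil>)) \<longlonglongrightarrow> G s" if "s \<in> D" for s
    using G[OF _ that, of "\<lambda>l. nat \<lceil>s / m l\<rceil>"] ceiling_seq[of s] D(2) that
    unfolding sim_const_iff by auto
  note lim = hit_dist_fun_tendsto_integral[OF D this]
  show "0 < t \<Longrightarrow> set_integrable lborel (D \<inter> {0..t}) G"
    by (rule lim) auto
  show "hit_times_converge M T A (\<lambda>t. LINT s:D \<inter> {0..t}|lborel. G s)"
    unfolding hit_times_converge_iff using lim by auto
qed

text \<open>The estimate on \<open>J\<close> holds for all indices \<open>k\<close> at once from
  some \<open>l\<close> on, so the threshold is common to all sequences in
  \<open>K_seqs M A J\<close>.\<close>

lemma sim_uniformly_hit_prob:
  assumes conv: "hit_times_converge M T A F"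
    and I: "open I" "I \<subseteq> {0<..}" "continuous_on I (rc_deriv F)" "\<And>t. t \<in> I \<Longrightarrow> 0 < rc_deriv F t"
    and J: "compact J" "J \<subseteq> I"
  shows "sim_uniformly (\<lambda>k l. hit_prob M T (A l) (k l))
    (\<lambda>k l. rc_deriv F (m l * real (k l)) * m l) (K_seqs M A J)"
  unfolding sim_uniformly_def
proof (intro allI impI)
  fix \<epsilon> :: real assume "0 < \<epsilon>"
  have "\<forall>\<^sub>F l in sequentially. \<forall>k\<ge>1. m l * real k \<in> J \<longrightarrow> \<bar>q l k / rc_deriv F (m l * real k) - 1\<bar> < \<epsilon>"
  proof (rule hit_prob_uniform_on_compact[OF conv J(1)])
    show "isCont (rc_deriv F) t" if "t \<in> J" for t
      using I(3) J(2) that continuous_on_eq_continuous_at[OF I(1)] by blast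
  qed (use I J \<open>0 < \<epsilon>\<close> in auto)
  then obtain l0 where l0: "\<And>l k. l0 \<le> l \<Longrightarrow> 1 \<le> k \<Longrightarrow> m l * real k \<in> J \<Longrightarrow>
      \<bar>q l k / rc_deriv F (m l * real k) - 1\<bar> < \<epsilon>"
    by (auto simp: eventually_at_top_linorder)
  show "\<exists>l0\<ge>1. \<forall>l\<ge>l0. \<forall>k\<in>K_seqs M A J.
      \<bar>hit_prob M T (A l) (k l) / (rc_deriv F (m l * real (k l)) * m l) - 1\<bar> < \<epsilon>"
  \<comment> \<open>Membership in \<open>K_seqs\<close> constrains the entries from index 1 on, so
    the threshold must be at least 1.\<close>
  proof (intro exI[of _ "max 1 l0"] conjI allI impI ballI)
    fix l k assume "max 1 l0 \<le> l" "k \<in> K_seqs M A J"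
    then show "\<bar>hit_prob M T (A l) (k l) / (rc_deriv F (m l * real (k l)) * m l) - 1\<bar> < \<epsilon>"
      using l0[of l "k l"] by (simp add: K_seqs_def pos_seqs_def mult.commute)
  qed simp
qed

end

theorem theorem2p1:
  fixes M :: "'a measure" and T :: "'a \<Rightarrow> 'a" and A :: "nat \<Rightarrow> 'a set"
  assumes "ergodic_system M T"
    and "\<forall>l\<ge>1. A l \<in> sets M"
    and "\<forall>l\<ge>1. 0 < measure M (A l)"
    and "(\<lambda>l. measure M (A l)) \<longlonglongrightarrow> 0"
  shows
    "(\<forall>F. hit_times_converge M T A F \<longrightarrow>
        (\<forall>k\<in>pos_seqs. \<forall>t>0.
           (\<lambda>l. measure M (A l) * real (k l)) \<longlonglongrightarrow> t \<longrightarrow> isCont (rc_deriv F) t \<longrightarrow>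
           sim_const (\<lambda>l. hit_prob M T (A l) (k l)) (rc_deriv F t) (\<lambda>l. measure M (A l))))
   \<and> (\<forall>D G.
        D \<in> sets borel \<longrightarrow> D \<subseteq> {0<..} \<longrightarrow> emeasure lborel ({0<..} - D) = 0 \<longrightarrow>
        (\<forall>t\<in>D. 0 \<le> G t) \<longrightarrow>
        (\<forall>k\<in>pos_seqs. \<forall>t\<in>D.
           (\<lambda>l. measure M (A l) * real (k l)) \<longlonglongrightarrow> t \<longrightarrow>
           sim_const (\<lambda>l. hit_prob M T (A l) (k l)) (G t) (\<lambda>l. measure M (A l))) \<longrightarrow>
        (\<forall>t>0. set_integrable lborel (D \<inter> {0..t}) G) \<and>
        hit_times_converge M T A (\<lambda>t. LINT s:D \<inter> {0..t}|lborel. G s))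
   \<and> (\<forall>F. hit_times_converge M T A F \<longrightarrow>
        (\<forall>I. open I \<longrightarrow> is_interval I \<longrightarrow> I \<subseteq> {0<..} \<longrightarrow>
           continuous_on I (rc_deriv F) \<longrightarrow> (\<forall>t\<in>I. 0 < rc_deriv F t) \<longrightarrow>
           (\<forall>J. compact J \<longrightarrow> J \<subseteq> I \<longrightarrow>
              sim_uniformly
                (\<lambda>k l. hit_prob M T (A l) (k l))
                (\<lambda>k l. rc_deriv F (measure M (A l) * real (k l)) * measure M (A l))
                (K_seqs M A J))))"
proof -
  interpret shrinking_targets M T A
    using assms by (simp add: shrinking_targets_def shrinking_targets_axioms_def)
  show ?thesis
  \<comment> \<open>Integrability and convergence in (b) become separate cases, so there are
    four.\<close>
  proof (intro conjI allI impI ballI, goal_cases)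
    case (1 F k t)
    show ?case
      by (rule sim_const_hit_prob[OF 1(1,2,3,4,5)])
  next
    case (2 D G t)
    show ?case
      using hit_times_converge_if_sim_const(1)[OF 2(1,2,3) _ 2(6)] 2(5) by blast
  next
    case (3 D G)
    show ?case
      using hit_times_converge_if_sim_const(2)[OF 3(1,2,3)] 3(5) by blast
  next
    case (4 F I J)
    show ?case
      using sim_uniformly_hit_prob[OF 4(1,2,4,5) _ 4(7,8)] 4(6) by blast
  qed
qed

end
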